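(* Let $m,n\ge 1$, let $\omega\in(0,1]$, and let $A\in\mathbb{R}^{m\times n}$ be a column distinct matrix with principal order matrix $\bar A$. If $(i_1,\ldots,i_n)\in\mathcal{I}(\bar A,\omega)$, then the following conditions hold: (i) $\{i_1,i_2,\ldots,i_n\}=M$; (ii) $mp\le \sum_{k\in N}\bar A(i_k,k)\le mp+n-m$, where $p=\lceil\omega n\rceil$.
   Context: Let $M=\{1,\ldots,m\}$, $N=\{1,\ldots,n\}$. For $\omega\in(0,1]$, $A\in\mathbb{R}^{m\times n}$ and $x\in\mathbb{R}^n$, $A\otimes_\omega x\in\mathbb{R}^m$ is the vector whose $i$-th entry is the $\lceil\omega n\rceil$-th smallest element (counted with multiplicity) of the multiset $\{A(i,j)+x_j : j\in N\}$. The normalized equation is $A\otimes_\omega x=\mathbf{0}$, with solution set $\mathcal{S}(A,\omega)=\{x\in\mathbb{R}^n : A\otimes_\omega x=\mathbf{0}\}$. For $x\in\mathcal{S}(A,\omega)$ put $\mathcal{I}(A,\omega,x)=\{(i_1,\ldots,i_n)\in M^n : A(i_k,k)+x_k=0\text{ for all }k\in N\}$, and define the set of solution indices $\mathcal{I}(A,\omega)=\bigcup_{x\in\mathcal{S}(A,\omega)}\mathcal{I}(A,\omega,x)$ (and likewise with $\bar A$ in place of $A$). $A$ is column distinct if, in each column of $A$, the entries are pairwise distinct. For column distinct $A$, the principal order matrix $\bar A$ is the $m\times n$ matrix with $\bar A(i,j)=k$ if $A(i,j)$ is the $k$-th smallest element of the column $A(\cdot,j)$. *)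

theory Defs
  imports "HOL-Analysis.Analysis" "HOL-Library.Multiset"
begin

(* An m x n real matrix is an element of real^'n^'m (row index type 'm, column index type 'n),
   so that M = (UNIV :: 'm set), m = CARD('m), N = (UNIV :: 'n set), n = CARD('n).
   Only the finiteness of the index sets matters, not their order. *)

(* k counts from 1, elements count with multiplicity; meaningful only for 1 <= k <= size X. *)
definition kth_smallest :: "nat \<Rightarrow> real multiset \<Rightarrow> real" where
  "kth_smallest k X = sorted_list_of_multiset X ! (k - 1)"

definition omega_prod :: "real^'n^'m \<Rightarrow> real \<Rightarrow> real^'n \<Rightarrow> real^'m" where
  "omega_prod A \<omega> x =
     (\<chi> i. kth_smallest (nat \<lceil>\<omega> * real CARD('n)\<rceil>) {# A $ i $ j + x $ j. j \<in># mset_set UNIV #})"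

definition solution_set :: "real^'n^'m \<Rightarrow> real \<Rightarrow> (real^'n) set" where
  "solution_set A \<omega> = {x. omega_prod A \<omega> x = 0}"

(* The tuple (i_1, ..., i_n) in M^n is a function from column indices to row indices. *)
definition indices_at :: "real^'n^'m \<Rightarrow> real^'n \<Rightarrow> ('n \<Rightarrow> 'm) set" where
  "indices_at A x = {i. \<forall>k. A $ i k $ k + x $ k = 0}"

definition solution_indices :: "real^'n^'m \<Rightarrow> real \<Rightarrow> ('n \<Rightarrow> 'm) set" where
  "solution_indices A \<omega> = (\<Union>x\<in>solution_set A \<omega>. indices_at A x)"

definition column_distinct :: "real^'n^'m \<Rightarrow> bool" where
  "column_distinct A \<longleftrightarrow> (\<forall>j. inj (\<lambda>i. A $ i $ j))"

(* The rank k is unique when A is column distinct, see principal_order_matrix_iff. *)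
definition principal_order_matrix :: "real^'n^'m \<Rightarrow> real^'n^'m" where
  "principal_order_matrix A =
     (\<chi> i j. real (THE k. k \<in> {1..CARD('m)} \<and>
                        A $ i $ j = kth_smallest k {# A $ l $ j. l \<in># mset_set UNIV #}))"

lemma ex1_column_rank:
  fixes A :: "real^'n^'m"
  assumes "column_distinct A"
  shows "\<exists>!k. k \<in> {1..CARD('m)} \<and> A $ i $ j = kth_smallest k {# A $ l $ j. l \<in># mset_set UNIV #}"
proof -
  define X where "X = {# A $ l $ j. l \<in># mset_set UNIV #}"
  define xs where "xs = sorted_list_of_multiset X"
  have inj: "inj (\<lambda>i. A $ i $ j)"
    using assms by (simp add: column_distinct_def)
  have X: "X = mset_set (range (\<lambda>i. A $ i $ j))"
    unfolding X_def using inj by (simp add: image_mset_mset_set)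
  have mset: "mset xs = X"
    by (simp add: xs_def)
  have dist: "distinct xs"
    unfolding xs_def X by simp
  have len: "length xs = CARD('m)"
    using arg_cong[OF mset, of size] by (simp add: X_def)
  have "set xs = range (\<lambda>i. A $ i $ j)"
    using arg_cong[OF mset, of set_mset] by (simp add: X_def)
  then obtain r where r: "r < length xs" "xs ! r = A $ i $ j"
    by (metis in_set_conv_nth rangeI)
  have "\<exists>!k. k \<in> {1..CARD('m)} \<and> A $ i $ j = xs ! (k - 1)"
  proof (rule ex1I[of _ "Suc r"])
    show "Suc r \<in> {1..CARD('m)} \<and> A $ i $ j = xs ! (Suc r - 1)"
      using r len by auto
  next
    fix k assume k: "k \<in> {1..CARD('m)} \<and> A $ i $ j = xs ! (k - 1)"
    then have "k - 1 < length xs"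
      using len by auto
    then have "k - 1 = r"
      using k r dist by (metis nth_eq_iff_index_eq)
    then show "k = Suc r"
      using k by auto
  qed
  then show ?thesis
    by (simp add: kth_smallest_def xs_def X_def)
qed

lemma principal_order_matrix_iff:
  fixes A :: "real^'n^'m"
  assumes "column_distinct A" and "k \<in> {1..CARD('m)}"
  shows "principal_order_matrix A $ i $ j = real k \<longleftrightarrow>
           A $ i $ j = kth_smallest k {# A $ l $ j. l \<in># mset_set UNIV #}"
  using theI'[OF ex1_column_rank[OF assms(1), of i j]] ex1_column_rank[OF assms(1), of i j] assms(2)
  unfolding principal_order_matrix_def by (simp only: vec_lambda_beta of_nat_eq_iff) blast

end

theory Submission
  imports Defs
begin

text \<open>
  Write \<open>B\<close> for the principal order matrix, with \<open>m\<close> rows and \<open>n\<close> columns, and \<open>p = \<lceil>\<omega> n\<rceil>\<close>.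
  A solution \<open>x\<close> with solution index \<open>i\<close> is forced to be
  \<open>x $ k = - B $ i k $ k\<close>, so the equation says that in every row \<open>r\<close> the \<open>p\<close>-th smallest of the
  differences \<open>B $ r $ k - B $ i k $ k\<close> is \<open>0\<close>. In particular some difference vanishes in row \<open>r\<close>,
  and since the columns of \<open>B\<close> have distinct entries, \<open>r = i k\<close> for that column \<open>k\<close>; this gives
  surjectivity.

  The bounds come from counting the pairs \<open>(r, k)\<close> with \<open>B $ r $ k \<le> B $ i k $ k\<close>, and those with
  strict inequality, in two ways. Column \<open>k\<close> of \<open>B\<close> is a permutation of \<open>1, \<dots>, m\<close>, so it contributes
  exactly \<open>B $ i k $ k\<close> pairs to the first count and \<open>B $ i k $ k - 1\<close> to the second
  (\<open>card_principal_order_le\<close>, \<open>card_principal_order_less\<close>). Each row contributes at least \<open>p\<close> to the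
  first and at most \<open>p - 1\<close> to the second, because \<open>0\<close> is its \<open>p\<close>-th smallest difference
  (\<open>kth_smallest_counts\<close>). Hence \<open>m p \<le> \<Sum>k. B $ i k $ k\<close> and \<open>(\<Sum>k. B $ i k $ k) - n \<le> m (p - 1)\<close>.
\<close>

lemma kth_smallest_counts:
  assumes "1 \<le> k" "k \<le> size X"
  shows kth_smallest_in: "kth_smallest k X \<in># X"
    and kth_smallest_count_le: "k \<le> size {#y \<in># X. y \<le> kth_smallest k X#}"
    and kth_smallest_count_less: "size {#y \<in># X. y < kth_smallest k X#} < k"
proof -
  define xs where "xs = sorted_list_of_multiset X"
  have X: "X = mset xs" and srt: "sorted xs"
    by (simp_all add: xs_def)
  have len: "k - 1 < length xs"
    using assms by (simp add: X)
  have kth: "kth_smallest k X = xs ! (k - 1)"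
    by (simp add: kth_smallest_def xs_def)
  have size: "size (filter_mset P X) = card {t. t < length xs \<and> P (xs ! t)}" for P
    unfolding X mset_filter[symmetric] size_mset by (rule length_filter_conv_card)
  show "kth_smallest k X \<in># X"
    unfolding kth using len by (simp add: X)
  have "{..<k} \<subseteq> {t. t < length xs \<and> xs ! t \<le> xs ! (k - 1)}"
    using len srt by (auto intro: sorted_nth_mono)
  from card_mono[OF _ this] show "k \<le> size {#y \<in># X. y \<le> kth_smallest k X#}"
    by (simp add: size kth)
  have "{t. t < length xs \<and> xs ! t < xs ! (k - 1)} \<subseteq> {..<k - 1}"
    using srt by (auto simp: sorted_iff_nth_mono) (meson leD leI)
  from card_mono[OF _ this] show "size {#y \<in># X. y < kth_smallest k X#} < k"
    using assms by (simp add: size kth)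
qed

lemma size_filter_image_UNIV:
  fixes f :: "'a::finite \<Rightarrow> 'b"
  shows "size {#y \<in># {#f a. a \<in># mset_set UNIV#}. P y#} = card {a. P (f a)}"
  by (simp add: filter_mset_image_mset filter_mset_mset_set)

text \<open>
  In a column without repetitions the entries below a given one are one fewer than those not
  above it, so the two counting bounds for the \<open>k\<close>-th smallest entry pin down \<open>k\<close>.
\<close>

lemma principal_order_eq_card:
  fixes A :: "real^'n^'m"
  assumes "column_distinct A"
  shows "principal_order_matrix A $ l $ j = real (card {r. A $ r $ j \<le> A $ l $ j})"
proof -
  let ?X = "{# A $ r $ j. r \<in># mset_set UNIV #}"
  obtain k where k: "k \<in> {1..CARD('m)}" and kth: "A $ l $ j = kth_smallest k ?X"
    using ex1_column_rank[OF assms] by blast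
  have "1 \<le> k" "k \<le> size ?X"
    using k by simp_all
  from kth_smallest_count_le[OF this] kth_smallest_count_less[OF this]
  have le: "k \<le> card {r. A $ r $ j \<le> A $ l $ j}" and less: "card {r. A $ r $ j < A $ l $ j} < k"
    by (simp_all only: kth[symmetric] size_filter_image_UNIV)
  have "{r. A $ r $ j \<le> A $ l $ j} = insert l {r. A $ r $ j < A $ l $ j}"
    using assms by (auto simp: column_distinct_def inj_def order_le_less)
  then have "k = card {r. A $ r $ j \<le> A $ l $ j}"
    using le less by simp
  then show ?thesis
    using principal_order_matrix_iff[OF assms k] kth by simp
qed

lemma principal_order_less_iff:
  fixes A :: "real^'n^'m"
  assumes "column_distinct A"
  shows "principal_order_matrix A $ r $ j < principal_order_matrix A $ l $ j
    \<longleftrightarrow> A $ r $ j < A $ l $ j"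
proof -
  have less: "principal_order_matrix A $ a $ j < principal_order_matrix A $ b $ j"
    if "A $ a $ j < A $ b $ j" for a b
  proof -
    have "{r. A $ r $ j \<le> A $ a $ j} \<subset> {r. A $ r $ j \<le> A $ b $ j}"
    proof
      show "{r. A $ r $ j \<le> A $ a $ j} \<subseteq> {r. A $ r $ j \<le> A $ b $ j}"
        using that by auto
      have "b \<in> {r. A $ r $ j \<le> A $ b $ j} - {r. A $ r $ j \<le> A $ a $ j}"
        using that by simp
      then show "{r. A $ r $ j \<le> A $ a $ j} \<noteq> {r. A $ r $ j \<le> A $ b $ j}"
        by blast
    qed
    then show ?thesis
      by (simp add: principal_order_eq_card[OF assms] psubset_card_mono)
  qed
  show ?thesis
  proof (cases "A $ r $ j" "A $ l $ j" rule: linorder_cases)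
    case equal
    then show ?thesis
      by (simp add: principal_order_eq_card[OF assms])
  qed (auto dest: less)
qed

lemma principal_order_eq_iff:
  fixes A :: "real^'n^'m"
  assumes "column_distinct A"
  shows "principal_order_matrix A $ r $ j = principal_order_matrix A $ l $ j \<longleftrightarrow> r = l"
proof
  assume "principal_order_matrix A $ r $ j = principal_order_matrix A $ l $ j"
  then have "A $ r $ j = A $ l $ j"
    using principal_order_less_iff[OF assms, of r j l] principal_order_less_iff[OF assms, of l j r]
    by simp
  then show "r = l"
    using assms by (auto simp: column_distinct_def dest: injD)
qed simp

lemma card_principal_order_le:
  fixes A :: "real^'n^'m"
  assumes "column_distinct A"
  shows "real (card {r. principal_order_matrix A $ r $ j \<le> principal_order_matrix A $ l $ j})
    = principal_order_matrix A $ l $ j"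
  using principal_order_less_iff[OF assms, of l j]
  by (simp add: not_less[symmetric] principal_order_eq_card[OF assms, of l])

lemma card_principal_order_less:
  fixes A :: "real^'n^'m"
  assumes "column_distinct A"
  shows "real (card {r. principal_order_matrix A $ r $ j < principal_order_matrix A $ l $ j})
    = principal_order_matrix A $ l $ j - 1"
proof -
  let ?B = "principal_order_matrix A"
  have "{r. ?B $ r $ j \<le> ?B $ l $ j} = insert l {r. ?B $ r $ j < ?B $ l $ j}"
    using principal_order_eq_iff[OF assms] by (auto simp: order_le_less)
  then have "card {r. ?B $ r $ j \<le> ?B $ l $ j} = Suc (card {r. ?B $ r $ j < ?B $ l $ j})"
    by simp
  then show ?thesis
    using card_principal_order_le[OF assms, of j l] by simp
qed

lemma sum_card_rows_eq_sum_card_columns: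
  fixes R :: "'a::finite \<Rightarrow> 'b::finite \<Rightarrow> bool"
  shows "(\<Sum>r\<in>UNIV. card {k. R r k}) = (\<Sum>k\<in>UNIV. card {r. R r k})"
  using sum_multicount_gen[of UNIV UNIV R "\<lambda>k. card {r. R r k}"] by simp

theorem proposition3p4:
  fixes A :: "real^'n^'m" and \<omega> :: real and i :: "'n \<Rightarrow> 'm"
  assumes "0 < \<omega>" and "\<omega> \<le> 1"
    and "column_distinct A"
    and "i \<in> solution_indices (principal_order_matrix A) \<omega>"
  shows "range i = (UNIV :: 'm set)
    \<and> real CARD('m) * real_of_int \<lceil>\<omega> * real CARD('n)\<rceil>
        \<le> (\<Sum>k\<in>UNIV. principal_order_matrix A $ i k $ k)
    \<and> (\<Sum>k\<in>UNIV. principal_order_matrix A $ i k $ k)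
        \<le> real CARD('m) * real_of_int \<lceil>\<omega> * real CARD('n)\<rceil> + real CARD('n) - real CARD('m)"
proof -
  let ?B = "principal_order_matrix A"
  define p where "p = nat \<lceil>\<omega> * real CARD('n)\<rceil>"
  have "0 < \<omega> * real CARD('n)" "\<omega> * real CARD('n) \<le> real CARD('n)"
    using assms(1,2) by (simp_all add: mult_le_cancel_right1)
  then have p: "1 \<le> p" "p \<le> CARD('n)" and p_ceiling: "real_of_int \<lceil>\<omega> * real CARD('n)\<rceil> = real p"
    unfolding p_def by linarith+

  obtain x where sol: "omega_prod ?B \<omega> x = 0" and "\<And>k. ?B $ i k $ k + x $ k = 0"
    using assms(4) by (auto simp: solution_indices_def solution_set_def indices_at_def)
  then have x: "x $ k = - ?B $ i k $ k" for k
    by (simp add: eq_neg_iff_add_eq_0 add.commute)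

  define D where "D r = {# ?B $ r $ k + x $ k. k \<in># mset_set UNIV #}" for r
  have kth: "kth_smallest p (D r) = 0" for r
    using arg_cong[OF sol, of "\<lambda>v. v $ r"] by (simp add: omega_prod_def D_def p_def)
  have pD: "1 \<le> p" "p \<le> size (D r)" for r
    using p by (simp_all add: D_def)
  have row_zero: "\<exists>k. ?B $ r $ k = ?B $ i k $ k" for r
    using kth_smallest_in[OF pD, of r] unfolding kth by (force simp: D_def x)
  have row_le: "p \<le> card {k. ?B $ r $ k \<le> ?B $ i k $ k}" for r
    using kth_smallest_count_le[OF pD, of r] unfolding kth
    unfolding D_def size_filter_image_UNIV by (simp add: x)
  have row_less: "card {k. ?B $ r $ k < ?B $ i k $ k} \<le> p - 1" for r
    using kth_smallest_count_less[OF pD, of r] unfolding kth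
    unfolding D_def size_filter_image_UNIV by (simp add: x)

  have "r \<in> range i" for r
    using row_zero[of r] principal_order_eq_iff[OF assms(3)] by blast
  then have surj: "range i = UNIV"
    by blast

  have "CARD('m) * p \<le> (\<Sum>r\<in>UNIV. card {k. ?B $ r $ k \<le> ?B $ i k $ k})"
    using sum_mono[of UNIV "\<lambda>_. p", OF row_le] by simp
  also have "\<dots> = (\<Sum>k\<in>UNIV. card {r. ?B $ r $ k \<le> ?B $ i k $ k})"
    by (rule sum_card_rows_eq_sum_card_columns)
  finally have "real (CARD('m) * p) \<le> real (\<Sum>k\<in>UNIV. card {r. ?B $ r $ k \<le> ?B $ i k $ k})"
    by (rule of_nat_mono)
  then have lower: "real CARD('m) * real p \<le> (\<Sum>k\<in>UNIV. ?B $ i k $ k)"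
    by (simp add: card_principal_order_le[OF assms(3)])

  have "(\<Sum>k\<in>UNIV. card {r. ?B $ r $ k < ?B $ i k $ k})
      = (\<Sum>r\<in>UNIV. card {k. ?B $ r $ k < ?B $ i k $ k})"
    by (rule sum_card_rows_eq_sum_card_columns[symmetric])
  also have "\<dots> \<le> CARD('m) * (p - 1)"
    using sum_mono[of UNIV _ "\<lambda>_. p - 1", OF row_less] by simp
  finally have "real (\<Sum>k\<in>UNIV. card {r. ?B $ r $ k < ?B $ i k $ k}) \<le> real (CARD('m) * (p - 1))"
    by (rule of_nat_mono)
  then have "(\<Sum>k\<in>UNIV. ?B $ i k $ k) - real CARD('n) \<le> real CARD('m) * (real p - 1)"
    using p(1) by (simp add: card_principal_order_less[OF assms(3)] sum_subtractf of_nat_diff)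
  then have upper: "(\<Sum>k\<in>UNIV. ?B $ i k $ k)
      \<le> real CARD('m) * real p + real CARD('n) - real CARD('m)"
    by (simp add: algebra_simps)

  show ?thesis
    unfolding p_ceiling using surj lower upper by blast
qed

end
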